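(* Let $G$ be a group of order $2^m$ of rank $5$ belonging to the isoclinism family $\Gamma_5$. Then (1) $\displaystyle A_G(t/|G|)=\frac{1-2^{-4}}{1-2^{-1}t} + \frac{2^{-4}}{1-t}$; (2) $\displaystyle B_G(t/|G|)=\frac{1}{1-2^{-4}t} + \frac{-3-2^{-1}-2^{-2}}{1-2^{-3}t} + \frac{3+2^{-1}+2^{-2}}{1-2^{-2}t}$.
   Context: For a finite group $G$ and $n\ge 0$, $\alpha_{G,n}$ denotes the number of orbits of $G$ acting on $G^n$ by simultaneous conjugation $g\cdot(x_1,\dots,x_n)=(gx_1g^{-1},\dots,gx_ng^{-1})$, and $\beta_{G,n}$ denotes the number of orbits of the same action on the set $G^{(n)}$ of $n$-tuples of pairwise commuting elements of $G$; $\alpha_{G,0}=\beta_{G,0}=1$. Set $A_G(t)=\sum_{n\ge 0}\alpha_{G,n}t^n$ and $B_G(t)=\sum_{n\ge 0}\beta_{G,n}t^n$ (formal power series, which are rational functions of $t$). $A_G(t/|G|)$, $B_G(t/|G|)$ denote the result of substituting $t/|G|$ for $t$. Finite groups $G,H$ are isoclinic if there are isomorphisms $\theta:G/Z(G)\to H/Z(H)$ and $\phi:G'\to H'$ (derived subgroups) such that $\phi([g_1,g_2])=[h_1,h_2]$ whenever $\theta(g_iZ(G))=h_iZ(H)$ for $i=1,2$. Isoclinism is an equivalence relation, whose classes are called isoclinism families. For a finite $2$-group $G$, the rank of (the family of) $G$ is the smallest $r$ such that the isoclinism family of $G$ contains a group of order $2^r$. $\Gamma_5$ (Hall–Senior notation)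 is the isoclinism family, of rank 5, of the group $\Gamma_5a_1$ of order $32$ generated by $\alpha_1,\alpha_2,\alpha_3,\alpha_4,\beta$ subject to $\alpha_1^2 = \alpha_2^2=\alpha_3^2 = \alpha_4^2 = \beta^2 = 1$, $\alpha_1\alpha_2\alpha_1^{-1}=\beta\alpha_2^{-1}$, $\alpha_1\alpha_4\alpha_1^{-1}=\beta\alpha_4^{-1}$, $\alpha_2\alpha_3\alpha_2^{-1}=\beta\alpha_3^{-1}$, where by convention pairs of generators for which no conjugation relation is listed commute. $G$ belongs to $\Gamma_5$ if $G$ is a finite $2$-group isoclinic to this group. *)

theory Defs
  imports "HOL-Algebra.Algebra" "HOL-Computational_Algebra.Formal_Power_Series"
begin

section \<open>Generating functions counting orbits of tuples\<close>

definition tuples :: "('a, 'b) monoid_scheme \<Rightarrow> nat \<Rightarrow> 'a list set" where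
  "tuples G n = {xs. length xs = n \<and> set xs \<subseteq> carrier G}"

definition commuting_tuples :: "('a, 'b) monoid_scheme \<Rightarrow> nat \<Rightarrow> 'a list set" where
  "commuting_tuples G n =
     {xs \<in> tuples G n. \<forall>x\<in>set xs. \<forall>y\<in>set xs. x \<otimes>\<^bsub>G\<^esub> y = y \<otimes>\<^bsub>G\<^esub> x}"

text \<open>The restriction to \<open>E\<close> makes this a \<^locale>\<open>group_action\<close>, whose maps are extensional on \<open>E\<close>.\<close>

definition simultaneous_conj ::
  "('a, 'b) monoid_scheme \<Rightarrow> 'a list set \<Rightarrow> 'a \<Rightarrow> 'a list \<Rightarrow> 'a list" where
  "simultaneous_conj G E = (\<lambda>g. \<lambda>xs\<in>E. map (\<lambda>x. g \<otimes>\<^bsub>G\<^esub> x \<otimes>\<^bsub>G\<^esub> inv\<^bsub>G\<^esub> g) xs)"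

definition alpha_count :: "('a, 'b) monoid_scheme \<Rightarrow> nat \<Rightarrow> nat" where
  "alpha_count G n = card (orbits G (tuples G n) (simultaneous_conj G (tuples G n)))"

definition beta_count :: "('a, 'b) monoid_scheme \<Rightarrow> nat \<Rightarrow> nat" where
  "beta_count G n = card (orbits G (commuting_tuples G n) (simultaneous_conj G (commuting_tuples G n)))"

definition A_series :: "('a, 'b) monoid_scheme \<Rightarrow> rat fps" where
  "A_series G = Abs_fps (\<lambda>n. of_nat (alpha_count G n))"

definition B_series :: "('a, 'b) monoid_scheme \<Rightarrow> rat fps" where
  "B_series G = Abs_fps (\<lambda>n. of_nat (beta_count G n))"

section \<open>Isoclinism\<close>

definition center :: "('a, 'b) monoid_scheme \<Rightarrow> 'a set" where
  "center G = {z \<in> carrier G. \<forall>g\<in>carrier G. z \<otimes>\<^bsub>G\<^esub> g = g \<otimes>\<^bsub>G\<^esub> z}"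

definition commutator :: "('a, 'b) monoid_scheme \<Rightarrow> 'a \<Rightarrow> 'a \<Rightarrow> 'a" where
  "commutator G x y = x \<otimes>\<^bsub>G\<^esub> y \<otimes>\<^bsub>G\<^esub> inv\<^bsub>G\<^esub> x \<otimes>\<^bsub>G\<^esub> inv\<^bsub>G\<^esub> y"

definition derived_group :: "('a, 'b) monoid_scheme \<Rightarrow> ('a, 'b) monoid_scheme" where
  "derived_group G = G\<lparr>carrier := derived G (carrier G)\<rparr>"

text \<open>The elements of \<^term>\<open>G Mod center G\<close> are the cosets \<^term>\<open>center G #>\<^bsub>G\<^esub> g\<close>.\<close>

definition isoclinic :: "('a, 'b) monoid_scheme \<Rightarrow> ('c, 'd) monoid_scheme \<Rightarrow> bool" where
  "isoclinic G H \<longleftrightarrow>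
     (\<exists>\<theta> \<in> iso (G Mod center G) (H Mod center H).
      \<exists>\<phi> \<in> iso (derived_group G) (derived_group H).
        \<forall>g1\<in>carrier G. \<forall>g2\<in>carrier G. \<forall>h1\<in>carrier H. \<forall>h2\<in>carrier H.
          \<theta> (center G #>\<^bsub>G\<^esub> g1) = center H #>\<^bsub>H\<^esub> h1 \<longrightarrow>
          \<theta> (center G #>\<^bsub>G\<^esub> g2) = center H #>\<^bsub>H\<^esub> h2 \<longrightarrow>
          \<phi> (commutator G g1 g2) = commutator H h1 h2)"

definition finite_two_group :: "('a, 'b) monoid_scheme \<Rightarrow> bool" where
  "finite_two_group G \<longleftrightarrow> group G \<and> (\<exists>k. order G = 2 ^ k)"

text \<open>Every finite group is isomorphic to one with carrier in \<^typ>\<open>nat\<close>, so letting the members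
  of the isoclinism family range over \<^typ>\<open>nat monoid\<close> loses none of the orders that occur.\<close>

definition isoclinism_rank :: "('a, 'b) monoid_scheme \<Rightarrow> nat" where
  "isoclinism_rank G =
     (LEAST r. \<exists>H :: nat monoid. group H \<and> order H = 2 ^ r \<and> isoclinic G H)"

section \<open>Groups given by generators and relations\<close>

datatype 'g letter = Pos 'g | Neg 'g

type_synonym 'g word = "'g letter list"

text \<open>Words over the generators and their formal inverses, modulo the congruence generated by
  free cancellation and the relations \<open>R\<close>, a pair \<open>(l, r)\<close> standing for the equation \<open>l = r\<close>.\<close>

inductive word_eq :: "('g word \<times> 'g word) set \<Rightarrow> 'g word \<Rightarrow> 'g word \<Rightarrow> bool"
  for R :: "('g word \<times> 'g word) set" where
  relation: "(l, r) \<in> R \<Longrightarrow> word_eq R l r"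
| cancel_right: "word_eq R [Pos x, Neg x] []"
| cancel_left: "word_eq R [Neg x, Pos x] []"
| reflexive: "word_eq R u u"
| symmetric: "word_eq R u v \<Longrightarrow> word_eq R v u"
| transitive: "word_eq R u v \<Longrightarrow> word_eq R v w \<Longrightarrow> word_eq R u w"
| congruence: "word_eq R u v \<Longrightarrow> word_eq R u' v' \<Longrightarrow> word_eq R (u @ u') (v @ v')"

definition word_class :: "('g word \<times> 'g word) set \<Rightarrow> 'g word \<Rightarrow> 'g word set" where
  "word_class R u = {v. word_eq R u v}"

definition presented_group :: "('g word \<times> 'g word) set \<Rightarrow> 'g word set monoid" where
  "presented_group R =
     \<lparr>carrier = range (word_class R),
      monoid.mult = (\<lambda>U V. \<Union>u\<in>U. \<Union>v\<in>V. word_class R (u @ v)),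
      one = word_class R []\<rparr>"

lemma word_class_eq_iff: "word_class R u = word_class R v \<longleftrightarrow> word_eq R u v"
proof
  assume "word_class R u = word_class R v"
  moreover have "v \<in> word_class R v"
    by (simp add: word_class_def word_eq.reflexive)
  ultimately have "v \<in> word_class R u" by simp
  then show "word_eq R u v"
    by (simp add: word_class_def)
next
  assume uv: "word_eq R u v"
  have "word_eq R u w \<longleftrightarrow> word_eq R v w" for w
    using word_eq.transitive[OF uv] word_eq.transitive[OF word_eq.symmetric[OF uv]] by blast
  then show "word_class R u = word_class R v"
    by (simp add: word_class_def)
qed

lemma presented_group_carrier: "carrier (presented_group R) = range (word_class R)"
  by (simp add: presented_group_def)

lemma presented_group_mult:
  "word_class R u \<otimes>\<^bsub>presented_group R\<^esub> word_class R v = word_class R (u @ v)"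
proof -
  have "word_class R (u' @ v') = word_class R (u @ v)"
    if "u' \<in> word_class R u" "v' \<in> word_class R v" for u' v'
  proof -
    have "word_eq R (u @ v) (u' @ v')"
      by (rule word_eq.congruence) (use that in \<open>simp_all add: word_class_def\<close>)
    then show ?thesis
      unfolding word_class_eq_iff by (rule word_eq.symmetric)
  qed
  moreover have "u \<in> word_class R u" "v \<in> word_class R v"
    by (simp_all add: word_class_def word_eq.reflexive)
  ultimately have "(\<Union>u'\<in>word_class R u. \<Union>v'\<in>word_class R v. word_class R (u' @ v')) =
      word_class R (u @ v)" by blast
  then show ?thesis
    by (simp add: presented_group_def)
qed

lemma word_inverse_exists: "\<exists>v. word_eq R (v @ u) []"
proof (induction u)
  case Nil
  have "word_eq R ([] @ []) []" by (simp add: word_eq.reflexive)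
  then show ?case ..
next
  case (Cons a u)
  from Cons.IH obtain v where v: "word_eq R (v @ u) []" ..
  have "\<exists>b. word_eq R [b, a] []"
  proof (cases a)
    case (Pos x)
    show ?thesis unfolding Pos by (rule exI, rule word_eq.cancel_left)
  next
    case (Neg x)
    show ?thesis unfolding Neg by (rule exI, rule word_eq.cancel_right)
  qed
  then obtain b where b: "word_eq R [b, a] []" ..
  have "word_eq R ([b, a] @ u) ([] @ u)"
    by (rule word_eq.congruence[OF b word_eq.reflexive])
  then have "word_eq R (v @ ([b, a] @ u)) (v @ ([] @ u))"
    by (rule word_eq.congruence[OF word_eq.reflexive])
  then have "word_eq R ((v @ [b]) @ (a # u)) (v @ u)" by simp
  then have "word_eq R ((v @ [b]) @ (a # u)) []" using v by (rule word_eq.transitive)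
  then show ?case ..
qed

lemma group_presented_group: "group (presented_group R)"
proof (rule groupI)
  have carr: "carrier (presented_group R) = range (word_class R)"
    and one: "\<one>\<^bsub>presented_group R\<^esub> = word_class R []"
    by (simp_all add: presented_group_def)
  show "\<one>\<^bsub>presented_group R\<^esub> \<in> carrier (presented_group R)"
    by (simp add: carr one)
  fix x assume "x \<in> carrier (presented_group R)"
  then obtain u where u: "x = word_class R u" by (auto simp: carr)
  show "\<one>\<^bsub>presented_group R\<^esub> \<otimes>\<^bsub>presented_group R\<^esub> x = x"
    by (simp add: u one presented_group_mult)
  from word_inverse_exists obtain v where "word_eq R (v @ u) []" ..
  then have "word_class R v \<otimes>\<^bsub>presented_group R\<^esub> x = \<one>\<^bsub>presented_group R\<^esub>"
    by (simp add: u one presented_group_mult word_class_eq_iff)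
  then show "\<exists>y\<in>carrier (presented_group R). y \<otimes>\<^bsub>presented_group R\<^esub> x = \<one>\<^bsub>presented_group R\<^esub>"
    by (auto simp: carr)
next
  fix x y
  assume "x \<in> carrier (presented_group R)" "y \<in> carrier (presented_group R)"
  then obtain u v where "x = word_class R u" "y = word_class R v"
    unfolding presented_group_carrier by blast
  then show "x \<otimes>\<^bsub>presented_group R\<^esub> y \<in> carrier (presented_group R)"
    by (simp add: presented_group_carrier presented_group_mult)
next
  fix x y z
  assume "x \<in> carrier (presented_group R)" "y \<in> carrier (presented_group R)"
    "z \<in> carrier (presented_group R)"
  then obtain u v w where "x = word_class R u" "y = word_class R v" "z = word_class R w"
    unfolding presented_group_carrier by blast
  then show "x \<otimes>\<^bsub>presented_group R\<^esub> y \<otimes>\<^bsub>presented_group R\<^esub> z =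
      x \<otimes>\<^bsub>presented_group R\<^esub> (y \<otimes>\<^bsub>presented_group R\<^esub> z)"
    by (simp add: presented_group_mult)
qed

section \<open>The family \<open>\<Gamma>\<^sub>5\<close>\<close>

datatype generator = Alpha1 | Alpha2 | Alpha3 | Alpha4 | Beta

text \<open>The third set makes all pairs of generators commute for which no conjugation relation is
  given in the second.\<close>

definition Gamma5a1_relations :: "(generator word \<times> generator word) set" where
  "Gamma5a1_relations =
     {([Pos x, Pos x], []) | x. x \<in> {Alpha1, Alpha2, Alpha3, Alpha4, Beta}} \<union>
     {([Pos x, Pos y, Neg x], [Pos Beta, Neg y]) | x y.
        (x, y) \<in> {(Alpha1, Alpha2), (Alpha1, Alpha4), (Alpha2, Alpha3)}} \<union>
     {([Pos x, Pos y], [Pos y, Pos x]) | x y.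
        (x, y) \<in> {(Alpha1, Alpha3), (Alpha2, Alpha4), (Alpha3, Alpha4),
                   (Alpha1, Beta), (Alpha2, Beta), (Alpha3, Beta), (Alpha4, Beta)}}"

definition Gamma5a1 :: "generator word set monoid" where
  "Gamma5a1 = presented_group Gamma5a1_relations"

definition belongs_to_Gamma5 :: "('a, 'b) monoid_scheme \<Rightarrow> bool" where
  "belongs_to_Gamma5 G \<longleftrightarrow> finite_two_group G \<and> isoclinic G Gamma5a1"

end

theory Submission
  imports Defs
begin

text \<open>The group \<open>\<Gamma>\<^sub>5a\<^sub>1\<close> is extraspecial: its commutator map is a nondegenerate alternating form on
  the quotient by the centre, a 4-dimensional space over the field with two elements. Isoclinism
  transports this form, so \<open>G / Z(G)\<close> has 16 elements and commutation in \<open>G\<close> is orthogonality for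
  the form. By Burnside, \<open>\<alpha>\<^sub>n |G|\<close> is the sum of \<open>|C(g)|\<^sup>n\<close> over \<open>g\<close>, where \<open>C(g)\<close> has index 1 or 2,
  and \<open>\<beta>\<^sub>n |G|\<close> is the number of commuting \<open>(n+1)\<close>-tuples. The latter equals \<open>|Z(G)|\<^sup>n\<^sup>+\<^sup>1\<close> times the
  number of tuples of pairwise orthogonal vectors, which is computed recursively by fixing the first
  entry.\<close>

section \<open>The alternating form\<close>

type_synonym vec4 = "bool \<times> bool \<times> bool \<times> bool"

text \<open>Booleans stand for the field with two elements, with \<open>\<noteq>\<close> as its
  addition and \<open>\<and>\<close> as its product. Identities between vectors then become
  propositional tautologies, and sums over all vectors can be evaluated outright.\<close>

fun vadd :: "vec4 \<Rightarrow> vec4 \<Rightarrow> vec4" where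
  "vadd (x1, x2, x3, x4) (y1, y2, y3, y4) = (x1 \<noteq> y1, x2 \<noteq> y2, x3 \<noteq> y3, x4 \<noteq> y4)"

definition vzero :: vec4 where
  "vzero = (False, False, False, False)"

text \<open>\<open>form p q\<close> says that elements with exponent vectors \<open>p\<close> and \<open>q\<close> do not commute; the three
  terms come from the relations \<open>[\<alpha>\<^sub>1, \<alpha>\<^sub>2] = [\<alpha>\<^sub>1, \<alpha>\<^sub>4] = [\<alpha>\<^sub>2, \<alpha>\<^sub>3] = \<beta>\<close>.\<close>

fun form :: "vec4 \<Rightarrow> vec4 \<Rightarrow> bool" where
  "form (x1, x2, x3, x4) (y1, y2, y3, y4) \<longleftrightarrow>
     ((x1 \<and> y2) \<noteq> (x2 \<and> y1)) \<noteq> (((x1 \<and> y4) \<noteq> (x4 \<and> y1)) \<noteq> ((x2 \<and> y3) \<noteq> (x3 \<and> y2)))"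

lemma vadd_vzero [simp]: "vadd vzero p = p" "vadd p vzero = p"
  by (cases p; simp add: vzero_def)+

lemma vadd_self [simp]: "vadd p p = vzero"
  by (cases p) (simp add: vzero_def)

lemma vadd_assoc: "vadd (vadd p q) r = vadd p (vadd q r)"
  by (cases p; cases q; cases r) (simp, argo)

lemma vadd_eq_vzero_iff [simp]: "vadd p q = vzero \<longleftrightarrow> p = q"
  by (metis vadd_assoc vadd_self vadd_vzero)

lemma vadd_eq_self_iff [simp]: "vadd p q = p \<longleftrightarrow> q = vzero" "vadd p q = q \<longleftrightarrow> p = vzero"
  by (metis vadd_assoc vadd_self vadd_vzero)+

lemma form_vzero [simp]: "\<not> form vzero p" "\<not> form p vzero"
  by (cases p; simp add: vzero_def)+

lemma form_self [simp]: "\<not> form p p"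
  by (cases p) auto

lemma form_sym: "form p q \<longleftrightarrow> form q p"
  by (cases p; cases q) (simp, argo)

lemma form_vadd_left: "form (vadd p q) r \<longleftrightarrow> (form p r \<noteq> form q r)"
proof -
  obtain x1 x2 x3 x4 where "r = (x1, x2, x3, x4)" by (cases r)
  then show ?thesis
    by (cases x1; cases x2; cases x3; cases x4; cases p; cases q) (simp; argo)+
qed

lemma form_vadd_right: "form p (vadd q r) \<longleftrightarrow> (form p q \<noteq> form p r)"
  using form_vadd_left form_sym by metis

text \<open>Pairing with the four basis vectors gives \<open>x2 + x4\<close>,
  \<open>x1 + x3\<close>, \<open>x2\<close> and \<open>x1\<close> in turn; if all four vanish, so
  does the vector.\<close>

lemma form_nondegenerate:
  assumes "\<And>q. \<not> form p q"
  shows "p = vzero"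
proof -
  obtain x1 x2 x3 x4 where p: "p = (x1, x2, x3, x4)"
    by (cases p)
  show ?thesis
    using assms[of "(True, False, False, False)"] assms[of "(False, True, False, False)"]
      assms[of "(False, False, True, False)"] assms[of "(False, False, False, True)"]
    by (simp add: p vzero_def)
qed

lemma card_vec4: "card {p :: vec4. P p} =
  (\<Sum>x1\<in>UNIV. \<Sum>x2\<in>UNIV. \<Sum>x3\<in>UNIV. \<Sum>x4\<in>UNIV. of_bool (P (x1, x2, x3, x4)))"
proof -
  have "card {p. P p} = (\<Sum>p\<in>UNIV. of_bool (P p))"
    by (simp add: of_bool_def sum.If_cases)
  also have "\<dots> = (\<Sum>x1\<in>UNIV. \<Sum>x2\<in>UNIV. \<Sum>x3\<in>UNIV. \<Sum>x4\<in>UNIV. of_bool (P (x1, x2, x3, x4)))"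
    by (simp only: sum.cartesian_product' UNIV_Times_UNIV[symmetric])
  finally show ?thesis .
qed

text \<open>By nondegeneracy the orthogonal complement of a nonzero vector is a hyperplane; the
  fifteen cases are evaluated one by one.\<close>

lemma card_orthogonal: "p \<noteq> vzero \<Longrightarrow> card {q. \<not> form p q} = 8"
proof -
  assume "p \<noteq> vzero"
  moreover obtain x1 x2 x3 x4 where "p = (x1, x2, x3, x4)" by (cases p)
  ultimately show ?thesis
    by (cases x1; cases x2; cases x3; cases x4)
      (simp_all add: card_vec4 UNIV_bool vzero_def del: sum_of_bool_eq)
qed

text \<open>The two vectors span an isotropic plane, and in dimension 4 a plane has a complement of
  dimension 2. So the plane is Lagrangian: it equals its own orthogonal complement.\<close>

lemma orthogonal_pair_eq:
  assumes "p \<noteq> vzero" "q \<noteq> vzero" "p \<noteq> q" "\<not> form p q"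
  shows "{r. \<not> form p r \<and> \<not> form q r} = {vzero, p, q, vadd p q}"
proof -
  have "r = vzero \<or> r = p \<or> r = q \<or> r = vadd p q" if "\<not> form p r" "\<not> form q r" for r
    using assms that
    by (cases p; cases q; cases r) (simp only: form.simps vadd.simps vzero_def prod.inject, sat)
  with assms show ?thesis
    by (auto simp: form_vadd_right form_sym)
qed

lemma card_orthogonal_pair:
  assumes "p \<noteq> vzero" "q \<noteq> vzero" "p \<noteq> q" "\<not> form p q"
  shows "card {r. \<not> form p r \<and> \<not> form q r} = 4"
  using assms by (simp add: orthogonal_pair_eq[OF assms] card_insert_if eq_commute[of _ "vadd p q"])

lemma orthogonal_pair_isotropic:
  assumes "p \<noteq> vzero" "q \<noteq> vzero" "p \<noteq> q" "\<not> form p q"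
    and "\<not> form p r" "\<not> form q r" "\<not> form p s" "\<not> form q s"
  shows "\<not> form r s"
proof -
  have "r \<in> {vzero, p, q, vadd p q}" "s \<in> {vzero, p, q, vadd p q}"
    using assms orthogonal_pair_eq[OF assms(1-4)] by blast+
  then show ?thesis
    using assms by (auto simp: form_vadd_left form_vadd_right form_sym)
qed

section \<open>Tuples of pairwise related elements\<close>

text \<open>A common frame for commuting tuples in a group and pairwise orthogonal tuples of
  vectors, so that one recursion serves both and the counts can be compared.\<close>

definition related_tuples :: "('a \<Rightarrow> 'a \<Rightarrow> bool) \<Rightarrow> 'a set \<Rightarrow> nat \<Rightarrow> 'a list set" where
  "related_tuples R S n =
     {xs. length xs = n \<and> set xs \<subseteq> S \<and> (\<forall>x\<in>set xs. \<forall>y\<in>set xs. R x y)}"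

lemma related_tuples_0 [simp]: "related_tuples R S 0 = {[]}"
  by (auto simp: related_tuples_def)

lemma finite_related_tuples [simp]: "finite S \<Longrightarrow> finite (related_tuples R S n)"
  by (rule finite_subset[OF _ finite_lists_length_eq[of S n]]) (auto simp: related_tuples_def)

text \<open>Once the first entry \<open>x\<close> is fixed, the remaining entries form a related
  tuple among the elements related to \<open>x\<close>. Reflexivity and symmetry supply the
  conditions on pairs that involve \<open>x\<close>.\<close>

lemma card_related_tuples_Suc:
  assumes "finite S" "\<And>x. x \<in> S \<Longrightarrow> R x x"
    and "\<And>x y. x \<in> S \<Longrightarrow> y \<in> S \<Longrightarrow> R x y \<Longrightarrow> R y x"
  shows "card (related_tuples R S (Suc n)) = (\<Sum>x\<in>S. card (related_tuples R {y \<in> S. R x y} n))"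
proof -
  have "related_tuples R S (Suc n) =
      (\<lambda>(x, xs). x # xs) ` (SIGMA x:S. related_tuples R {y \<in> S. R x y} n)"
    using assms(2,3) by (fastforce simp: related_tuples_def length_Suc_conv image_iff)
  moreover have "inj_on (\<lambda>(x, xs). x # xs) (SIGMA x:S. related_tuples R {y \<in> S. R x y} n)"
    by (auto intro: inj_onI)
  ultimately show ?thesis
    using assms(1) by (simp add: card_image)
qed

lemma card_related_tuples_total:
  assumes "finite S" "\<And>x y. x \<in> S \<Longrightarrow> y \<in> S \<Longrightarrow> R x y"
  shows "card (related_tuples R S n) = card S ^ n"
proof -
  have "related_tuples R S n = {xs. set xs \<subseteq> S \<and> length xs = n}"
    using assms(2) by (auto simp: related_tuples_def)
  with assms(1) show ?thesis
    by (simp add: card_lists_length_eq)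
qed

text \<open>Intended for the coordinate map from the group to the sixteen vectors, whose fibres are
  the cosets of the centre and hence all have the same size.\<close>

lemma sum_constant_fibres:
  fixes f :: "'b :: finite \<Rightarrow> nat"
  assumes "finite S" "\<And>p. card {x \<in> S. V x = p} = z"
  shows "(\<Sum>x\<in>S. f (V x)) = z * (\<Sum>p\<in>UNIV. f p)"
proof -
  have "(\<Sum>x\<in>S. f (V x)) = (\<Sum>p\<in>UNIV. \<Sum>x\<in>{x \<in> S. V x = p}. f (V x))"
    using assms(1) by (intro sum.group[symmetric]) auto
  also have "\<dots> = (\<Sum>p\<in>UNIV. z * f p)"
    by (intro sum.cong refl) (simp add: assms(2))
  finally show ?thesis
    by (simp add: sum_distrib_left)
qed

lemma card_constant_fibres:
  fixes P :: "'b :: finite \<Rightarrow> bool"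
  assumes "finite S" "\<And>p. card {x \<in> S. V x = p} = z"
  shows "card {x \<in> S. P (V x)} = z * card {p. P p}"
  using sum_constant_fibres[OF assms, of "\<lambda>p. of_bool (P p)"] assms(1)
  by (simp add: of_bool_def sum.If_cases Int_def)

text \<open>Every entry of a tuple of vectors lifts in \<open>z\<close> ways, independently of the
  others. The predicate \<open>P\<close> is there for the induction: fixing the first entry
  restricts the others to a smaller set, which is again a preimage under \<open>V\<close>.\<close>

lemma card_related_tuples_fibres:
  fixes V :: "'a \<Rightarrow> 'b :: finite"
  assumes S: "finite S" "\<And>p. card {x \<in> S. V x = p} = z"
    and R: "\<And>p. R p p" "\<And>p q. R p q \<Longrightarrow> R q p"
  shows "card (related_tuples (\<lambda>x y. R (V x) (V y)) {x \<in> S. P (V x)} n) =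
    z ^ n * card (related_tuples R {p. P p} n)"
proof (induction n arbitrary: P)
  case (Suc n)
  let ?N = "\<lambda>p. card (related_tuples R {q. P q \<and> R p q} n)"
  have "card (related_tuples (\<lambda>x y. R (V x) (V y)) {x \<in> S. P (V x)} (Suc n)) =
      (\<Sum>x\<in>{x \<in> S. P (V x)}. card (related_tuples (\<lambda>x y. R (V x) (V y))
          {y \<in> S. P (V y) \<and> R (V x) (V y)} n))"
    by (subst card_related_tuples_Suc) (use S(1) R in \<open>auto simp: conj_assoc\<close>)
  also have "\<dots> = (\<Sum>x\<in>S. if P (V x) then z ^ n * ?N (V x) else 0)"
    using S(1) Suc.IH[of "\<lambda>q. P q \<and> R p q" for p] by (simp add: sum.If_cases Int_def)
  also have "\<dots> = z * (\<Sum>p\<in>UNIV. if P p then z ^ n * ?N p else 0)"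
    by (rule sum_constant_fibres[OF S])
  also have "\<dots> = z ^ Suc n * (\<Sum>p\<in>{p. P p}. ?N p)"
    by (simp add: sum.If_cases sum_distrib_left mult.assoc)
  also have "(\<Sum>p\<in>{p. P p}. ?N p) = card (related_tuples R {p. P p} (Suc n))"
    by (subst card_related_tuples_Suc) (use R in auto)
  finally show ?case .
qed simp

section \<open>Counting tuples of pairwise orthogonal vectors\<close>

lemma card_vec4_UNIV: "card (UNIV :: vec4 set) = 16"
  using card_vec4[of "\<lambda>_. True"] by (simp add: UNIV_bool)

text \<open>Solves a(n+1) = 2 a(n) + 6 * 4^n with a(0) = 1. Of the 8 possible first entries,
  \<open>vzero\<close> and \<open>p\<close> put no new condition on the rest, while each of the
  other 6 confines the rest to a Lagrangian plane, where any 4^n choices are allowed. Integers avoid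
  truncated subtraction.\<close>

lemma card_isotropic_tuples_orthogonal:
  assumes p: "p \<noteq> vzero"
  shows "int (card (related_tuples (\<lambda>q r. \<not> form q r) {q. \<not> form p q} n)) = 3 * 4 ^ n - 2 * 2 ^ n"
proof (induction n)
  case (Suc n)
  let ?R = "\<lambda>q r. \<not> form q r"
  let ?N = "\<lambda>q. card (related_tuples ?R {r. \<not> form p r \<and> \<not> form q r} n)"
  have rad: "?N q = card (related_tuples ?R {r. \<not> form p r} n)" if "q \<in> {vzero, p}" for q
    using that by auto
  have nonrad: "?N q = 4 ^ n" if "q \<in> {q. \<not> form p q} - {vzero, p}" for q
    using that p orthogonal_pair_isotropic[of p q]
    by (subst card_related_tuples_total) (auto simp: card_orthogonal_pair)
  have "card (related_tuples ?R {q. \<not> form p q} (Suc n)) = (\<Sum>q\<in>{q. \<not> form p q}. ?N q)"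
    by (subst card_related_tuples_Suc) (auto simp: form_sym)
  also have "\<dots> = (\<Sum>q\<in>{q. \<not> form p q} - {vzero, p}. ?N q) + (\<Sum>q\<in>{vzero, p}. ?N q)"
    by (rule sum.subset_diff) auto
  also have "(\<Sum>q\<in>{vzero, p}. ?N q) = 2 * card (related_tuples ?R {r. \<not> form p r} n)"
    using p by (subst sum.cong[OF refl rad]) (auto simp: card_insert_if)
  also have "(\<Sum>q\<in>{q. \<not> form p q} - {vzero, p}. ?N q) = 6 * 4 ^ n"
    using p by (subst sum.cong[OF refl nonrad]) (auto simp: card_Diff_subset card_orthogonal)
  finally show ?case
    by (simp add: Suc.IH algebra_simps)
qed simp

text \<open>Solves b(n+1) = b(n) + 15 (3 * 4^n - 2 * 2^n) with b(0) = 1: the first entry is zero, or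
  one of 15 nonzero vectors to which the preceding count applies.\<close>

lemma card_isotropic_tuples:
  "int (card (related_tuples (\<lambda>p q. \<not> form p q) UNIV n)) = 15 * 4 ^ n - 30 * 2 ^ n + 16"
proof (induction n)
  case (Suc n)
  let ?R = "\<lambda>q r. \<not> form q r"
  let ?N = "\<lambda>p. int (card (related_tuples ?R {q. \<not> form p q} n))"
  have "int (card (related_tuples ?R UNIV (Suc n))) = (\<Sum>p\<in>UNIV. ?N p)"
    by (subst card_related_tuples_Suc) (auto simp: form_sym)
  also have "\<dots> = ?N vzero + (\<Sum>p\<in>UNIV - {vzero}. ?N p)"
    by (rule sum.remove) auto
  also have "(\<Sum>p\<in>UNIV - {vzero}. ?N p) = (\<Sum>p\<in>UNIV - {vzero :: vec4}. 3 * 4 ^ n - 2 * 2 ^ n)"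
    by (intro sum.cong refl card_isotropic_tuples_orthogonal) simp
  also have "\<dots> = 15 * (3 * 4 ^ n - 2 * 2 ^ n)"
    by (simp add: card_Diff_subset card_vec4_UNIV)
  finally show ?case
    by (simp add: Suc.IH algebra_simps)
qed simp

section \<open>The group \<open>\<Gamma>\<^sub>5a\<^sub>1\<close>\<close>

text \<open>Forgetting the sign of a letter is harmless here, because every generator is an
  involution.\<close>

primrec base :: "'g letter \<Rightarrow> 'g" where
  "base (Pos x) = x"
| "base (Neg x) = x"

fun unit_vec :: "generator \<Rightarrow> vec4" where
  "unit_vec Alpha1 = (True, False, False, False)"
| "unit_vec Alpha2 = (False, True, False, False)"
| "unit_vec Alpha3 = (False, False, True, False)"
| "unit_vec Alpha4 = (False, False, False, True)"
| "unit_vec Beta = (False, False, False, False)"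

text \<open>A normal form \<open>\<alpha>\<^sub>1\<^bsup>x\<^sub>1\<^esup> \<alpha>\<^sub>2\<^bsup>x\<^sub>2\<^esup> \<alpha>\<^sub>3\<^bsup>x\<^sub>3\<^esup> \<alpha>\<^sub>4\<^bsup>x\<^sub>4\<^esup> \<beta>\<^bsup>b\<^esup>\<close> is encoded by its exponents;
  a generator acts on it by left multiplication.\<close>

fun left_mult :: "generator \<Rightarrow> vec4 \<times> bool \<Rightarrow> vec4 \<times> bool" where
  "left_mult Alpha1 ((x1, x2, x3, x4), b) = ((\<not> x1, x2, x3, x4), b)"
| "left_mult Alpha2 ((x1, x2, x3, x4), b) = ((x1, \<not> x2, x3, x4), b \<noteq> x1)"
| "left_mult Alpha3 ((x1, x2, x3, x4), b) = ((x1, x2, \<not> x3, x4), b \<noteq> x2)"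
| "left_mult Alpha4 ((x1, x2, x3, x4), b) = ((x1, x2, x3, \<not> x4), b \<noteq> x1)"
| "left_mult Beta ((x1, x2, x3, x4), b) = ((x1, x2, x3, x4), \<not> b)"

definition word_act :: "generator word \<Rightarrow> vec4 \<times> bool \<Rightarrow> vec4 \<times> bool" where
  "word_act w = foldr (\<lambda>l. left_mult (base l)) w"

lemma word_act_simps [simp]:
  "word_act [] s = s"
  "word_act (l # w) s = left_mult (base l) (word_act w s)"
  "word_act (u @ v) s = word_act u (word_act v s)"
  by (simp_all add: word_act_def)

lemma left_mult_twice [simp]: "left_mult x (left_mult x s) = s"
proof -
  obtain x1 x2 x3 x4 b where "s = ((x1, x2, x3, x4), b)" by (metis prod.exhaust)
  then show ?thesis by (cases x) auto
qed

lemma fst_left_mult: "fst (left_mult x s) = vadd (unit_vec x) (fst s)"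
proof -
  obtain x1 x2 x3 x4 b where "s = ((x1, x2, x3, x4), b)" by (metis prod.exhaust)
  then show ?thesis by (cases x) auto
qed

lemma left_mult_Beta: "left_mult Beta s \<noteq> s"
proof -
  obtain x1 x2 x3 x4 b where "s = ((x1, x2, x3, x4), b)" by (metis prod.exhaust)
  then show ?thesis by auto
qed

text \<open>The action on normal forms respects all defining relations, so it descends to the
  presented group. It serves to show that the presentation does not collapse.\<close>

lemma word_act_cong:
  assumes "word_eq Gamma5a1_relations u v"
  shows "word_act u s = word_act v s"
  using assms
proof (induction arbitrary: s)
  case (relation l r)
  obtain x1 x2 x3 x4 b where "s = ((x1, x2, x3, x4), b)" by (metis prod.exhaust)
  with relation show ?case
    unfolding Gamma5a1_relations_def by (elim UnE) auto
qed auto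

text \<open>Read off from the action on the normal form of the identity, which makes invariance
  under the relations immediate.\<close>

definition exponents :: "generator word \<Rightarrow> vec4" where
  "exponents w = fst (word_act w (vzero, False))"

lemma exponents_simps [simp]:
  "exponents [] = vzero"
  "exponents (l # w) = vadd (unit_vec (base l)) (exponents w)"
  by (simp_all add: exponents_def fst_left_mult)

lemma exponents_append [simp]: "exponents (u @ v) = vadd (exponents u) (exponents v)"
  by (induction u) (simp_all add: vadd_assoc)

lemma exponents_surj: "\<exists>w. exponents w = p"
proof -
  obtain x1 x2 x3 x4 where p: "p = (x1, x2, x3, x4)" by (cases p)
  let ?l = "\<lambda>b x. if b then [Pos x] else []"
  have "exponents (?l x1 Alpha1 @ ?l x2 Alpha2 @ ?l x3 Alpha3 @ ?l x4 Alpha4) = p"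
    by (simp add: p vzero_def)
  then show ?thesis ..
qed

section \<open>Commutation in the presented group in terms of exponent vectors\<close>

abbreviation elt :: "generator word \<Rightarrow> generator word set" where
  "elt \<equiv> word_class Gamma5a1_relations"

lemma group_Gamma5a1: "group Gamma5a1"
  by (simp add: Gamma5a1_def group_presented_group)

interpretation Gamma5a1: group Gamma5a1
  by (rule group_Gamma5a1)

lemma elt_append: "elt (u @ v) = elt u \<otimes>\<^bsub>Gamma5a1\<^esub> elt v"
  by (simp add: Gamma5a1_def presented_group_mult)

lemma elt_Cons: "elt (l # w) = elt [l] \<otimes>\<^bsub>Gamma5a1\<^esub> elt w"
  using elt_append[of "[l]" w] by simp

lemma elt_Nil [simp]: "elt [] = \<one>\<^bsub>Gamma5a1\<^esub>"
  by (simp add: Gamma5a1_def presented_group_def)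

lemma carrier_Gamma5a1: "carrier Gamma5a1 = range elt"
  by (simp add: Gamma5a1_def presented_group_carrier)

lemma elt_closed [simp]: "elt w \<in> carrier Gamma5a1"
  by (simp add: carrier_Gamma5a1)

lemma elt_eq_exponents: "elt u = elt v \<Longrightarrow> exponents u = exponents v"
  by (simp add: word_class_eq_iff exponents_def word_act_cong)

lemma elt_relation: "(l, r) \<in> Gamma5a1_relations \<Longrightarrow> elt l = elt r"
  by (simp add: word_class_eq_iff word_eq.relation)

lemma elt_square: "elt [Pos x] \<otimes>\<^bsub>Gamma5a1\<^esub> elt [Pos x] = \<one>\<^bsub>Gamma5a1\<^esub>"
proof -
  have "([Pos x, Pos x], []) \<in> Gamma5a1_relations"
    by (cases x) (auto simp: Gamma5a1_relations_def)
  from elt_relation[OF this] show ?thesis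
    by (simp add: elt_Cons[of _ "[_]"])
qed

lemma elt_Neg: "elt [Neg x] = elt [Pos x]"
proof -
  have "elt [Neg x, Pos x] = elt []"
    by (simp add: word_class_eq_iff word_eq.cancel_left del: elt_Nil)
  then have "elt [Neg x] \<otimes>\<^bsub>Gamma5a1\<^esub> elt [Pos x] = \<one>\<^bsub>Gamma5a1\<^esub>"
    by (simp add: elt_Cons[of _ "[_]"])
  then show ?thesis
    using elt_square[of x] Gamma5a1.r_cancel by (metis elt_closed)
qed

lemma elt_base: "elt [l] = elt [Pos (base l)]"
  by (cases l) (simp_all add: elt_Neg)

lemma generators_commute:
  assumes "([Pos x, Pos y], [Pos y, Pos x]) \<in> Gamma5a1_relations"
  shows "elt [Pos x] \<otimes>\<^bsub>Gamma5a1\<^esub> elt [Pos y] = elt [Pos y] \<otimes>\<^bsub>Gamma5a1\<^esub> elt [Pos x]"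
  by (simp only: elt_append[symmetric] append.simps elt_relation[OF assms])

lemma Beta_commutes:
  "elt w \<otimes>\<^bsub>Gamma5a1\<^esub> elt [Pos Beta] = elt [Pos Beta] \<otimes>\<^bsub>Gamma5a1\<^esub> elt w"
proof (induction w)
  case (Cons l w)
  have l: "elt [l] \<otimes>\<^bsub>Gamma5a1\<^esub> elt [Pos Beta] = elt [Pos Beta] \<otimes>\<^bsub>Gamma5a1\<^esub> elt [l]"
  proof (cases "base l = Beta")
    case False
    then have "([Pos (base l), Pos Beta], [Pos Beta, Pos (base l)]) \<in> Gamma5a1_relations"
      by (cases "base l") (auto simp: Gamma5a1_relations_def)
    then show ?thesis
      by (simp add: elt_base[of l] generators_commute)
  qed (simp add: elt_base[of l])
  have "elt (l # w) \<otimes>\<^bsub>Gamma5a1\<^esub> elt [Pos Beta] =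
      elt [l] \<otimes>\<^bsub>Gamma5a1\<^esub> (elt [Pos Beta] \<otimes>\<^bsub>Gamma5a1\<^esub> elt w)"
    by (simp add: elt_Cons[of l w] Gamma5a1.m_assoc Cons.IH)
  also have "\<dots> = elt [Pos Beta] \<otimes>\<^bsub>Gamma5a1\<^esub> elt (l # w)"
    by (simp add: elt_Cons[of l w] l flip: Gamma5a1.m_assoc)
  finally show ?case .
qed simp

definition beta_power :: "bool \<Rightarrow> generator word set" where
  "beta_power b = (if b then elt [Pos Beta] else \<one>\<^bsub>Gamma5a1\<^esub>)"

lemma beta_power_closed [simp]: "beta_power b \<in> carrier Gamma5a1"
  by (simp add: beta_power_def)

lemma beta_power_commutes:
  "elt w \<otimes>\<^bsub>Gamma5a1\<^esub> beta_power b = beta_power b \<otimes>\<^bsub>Gamma5a1\<^esub> elt w"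
  by (simp add: beta_power_def Beta_commutes)

lemma beta_power_mult: "beta_power a \<otimes>\<^bsub>Gamma5a1\<^esub> beta_power b = beta_power (a \<noteq> b)"
  by (simp add: beta_power_def elt_square)

text \<open>Since generators are involutions, the relation says xy = \<beta>yx; multiplying by
  \<beta> and using \<beta>^2 = 1 gives the version with x and y exchanged.\<close>

lemma conjugation_relation:
  assumes "([Pos x, Pos y, Neg x], [Pos Beta, Neg y]) \<in> Gamma5a1_relations"
  shows "elt [Pos x] \<otimes>\<^bsub>Gamma5a1\<^esub> elt [Pos y] =
      elt [Pos Beta] \<otimes>\<^bsub>Gamma5a1\<^esub> (elt [Pos y] \<otimes>\<^bsub>Gamma5a1\<^esub> elt [Pos x])" (is ?th1)
    and "elt [Pos y] \<otimes>\<^bsub>Gamma5a1\<^esub> elt [Pos x] =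
      elt [Pos Beta] \<otimes>\<^bsub>Gamma5a1\<^esub> (elt [Pos x] \<otimes>\<^bsub>Gamma5a1\<^esub> elt [Pos y])"
proof -
  have "elt [Pos x] \<otimes>\<^bsub>Gamma5a1\<^esub> (elt [Pos y] \<otimes>\<^bsub>Gamma5a1\<^esub> elt [Neg x]) =
      elt [Pos Beta] \<otimes>\<^bsub>Gamma5a1\<^esub> elt [Neg y]"
    by (simp only: elt_append[symmetric] append.simps elt_relation[OF assms])
  then have "elt [Pos x] \<otimes>\<^bsub>Gamma5a1\<^esub> (elt [Pos y] \<otimes>\<^bsub>Gamma5a1\<^esub> elt [Pos x]) =
      elt [Pos Beta] \<otimes>\<^bsub>Gamma5a1\<^esub> elt [Pos y]"
    by (simp only: elt_Neg)
  then have "elt [Pos x] \<otimes>\<^bsub>Gamma5a1\<^esub> elt [Pos y] \<otimes>\<^bsub>Gamma5a1\<^esub> (elt [Pos x] \<otimes>\<^bsub>Gamma5a1\<^esub> elt [Pos x]) =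
      elt [Pos Beta] \<otimes>\<^bsub>Gamma5a1\<^esub> elt [Pos y] \<otimes>\<^bsub>Gamma5a1\<^esub> elt [Pos x]"
    by (metis Gamma5a1.m_assoc Gamma5a1.m_closed elt_closed)
  then show ?th1
    by (simp add: elt_square Gamma5a1.m_assoc)
  have "elt [Pos Beta] \<otimes>\<^bsub>Gamma5a1\<^esub> (elt [Pos Beta] \<otimes>\<^bsub>Gamma5a1\<^esub> (elt [Pos y] \<otimes>\<^bsub>Gamma5a1\<^esub> elt [Pos x])) =
     elt [Pos y] \<otimes>\<^bsub>Gamma5a1\<^esub> elt [Pos x]"
    by (simp add: elt_square flip: Gamma5a1.m_assoc)
  with \<open>?th1\<close> show "elt [Pos y] \<otimes>\<^bsub>Gamma5a1\<^esub> elt [Pos x] =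
      elt [Pos Beta] \<otimes>\<^bsub>Gamma5a1\<^esub> (elt [Pos x] \<otimes>\<^bsub>Gamma5a1\<^esub> elt [Pos y])"
    by simp
qed

lemma generators_swap:
  "elt [Pos x] \<otimes>\<^bsub>Gamma5a1\<^esub> elt [Pos y] =
     beta_power (form (unit_vec x) (unit_vec y)) \<otimes>\<^bsub>Gamma5a1\<^esub> (elt [Pos y] \<otimes>\<^bsub>Gamma5a1\<^esub> elt [Pos x])"
proof -
  consider "x = y" | "([Pos x, Pos y], [Pos y, Pos x]) \<in> Gamma5a1_relations"
    | "([Pos y, Pos x], [Pos x, Pos y]) \<in> Gamma5a1_relations"
    | "([Pos x, Pos y, Neg x], [Pos Beta, Neg y]) \<in> Gamma5a1_relations"
    | "([Pos y, Pos x, Neg y], [Pos Beta, Neg x]) \<in> Gamma5a1_relations"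
    by (cases x; cases y) (auto simp: Gamma5a1_relations_def)
  then show ?thesis
  proof cases
    case 1
    then show ?thesis by (simp add: beta_power_def)
  next
    case 2
    then have "\<not> form (unit_vec x) (unit_vec y)"
      by (auto simp: Gamma5a1_relations_def)
    with generators_commute[OF 2] show ?thesis by (simp add: beta_power_def)
  next
    case 3
    then have "\<not> form (unit_vec x) (unit_vec y)"
      by (auto simp: Gamma5a1_relations_def)
    with generators_commute[OF 3] show ?thesis by (simp add: beta_power_def)
  next
    case 4
    then have "form (unit_vec x) (unit_vec y)"
      by (auto simp: Gamma5a1_relations_def)
    with conjugation_relation(1)[OF 4] show ?thesis by (simp add: beta_power_def)
  next
    case 5
    then have "form (unit_vec x) (unit_vec y)"
      by (auto simp: Gamma5a1_relations_def)
    with conjugation_relation(2)[OF 5] show ?thesis by (simp add: beta_power_def)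
  qed
qed

lemma letter_word_swap:
  "elt [l] \<otimes>\<^bsub>Gamma5a1\<^esub> elt v =
     beta_power (form (unit_vec (base l)) (exponents v)) \<otimes>\<^bsub>Gamma5a1\<^esub> (elt v \<otimes>\<^bsub>Gamma5a1\<^esub> elt [l])"
proof (induction v)
  case Nil
  then show ?case by (simp add: beta_power_def)
next
  case (Cons k v)
  let ?b = "beta_power (form (unit_vec (base l)) (unit_vec (base k)))"
  let ?c = "beta_power (form (unit_vec (base l)) (exponents v))"
  have "elt [l] \<otimes>\<^bsub>Gamma5a1\<^esub> elt (k # v) = elt [l] \<otimes>\<^bsub>Gamma5a1\<^esub> elt [k] \<otimes>\<^bsub>Gamma5a1\<^esub> elt v"
    by (simp add: elt_Cons[of k v] Gamma5a1.m_assoc)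
  also have "elt [l] \<otimes>\<^bsub>Gamma5a1\<^esub> elt [k] = ?b \<otimes>\<^bsub>Gamma5a1\<^esub> (elt [k] \<otimes>\<^bsub>Gamma5a1\<^esub> elt [l])"
    by (simp only: elt_base[of l] elt_base[of k] generators_swap[of "base l" "base k"])
  also have "\<dots> \<otimes>\<^bsub>Gamma5a1\<^esub> elt v = ?b \<otimes>\<^bsub>Gamma5a1\<^esub> (elt [k] \<otimes>\<^bsub>Gamma5a1\<^esub> (elt [l] \<otimes>\<^bsub>Gamma5a1\<^esub> elt v))"
    by (simp add: Gamma5a1.m_assoc)
  also have "elt [k] \<otimes>\<^bsub>Gamma5a1\<^esub> (elt [l] \<otimes>\<^bsub>Gamma5a1\<^esub> elt v) =
      (elt [k] \<otimes>\<^bsub>Gamma5a1\<^esub> ?c) \<otimes>\<^bsub>Gamma5a1\<^esub> (elt v \<otimes>\<^bsub>Gamma5a1\<^esub> elt [l])"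
    by (simp add: Cons.IH Gamma5a1.m_assoc)
  also have "\<dots> = ?c \<otimes>\<^bsub>Gamma5a1\<^esub> (elt (k # v) \<otimes>\<^bsub>Gamma5a1\<^esub> elt [l])"
    by (simp add: beta_power_commutes elt_Cons[of k v] Gamma5a1.m_assoc)
  also have "?b \<otimes>\<^bsub>Gamma5a1\<^esub> \<dots> = (?b \<otimes>\<^bsub>Gamma5a1\<^esub> ?c) \<otimes>\<^bsub>Gamma5a1\<^esub> (elt (k # v) \<otimes>\<^bsub>Gamma5a1\<^esub> elt [l])"
    by (simp add: Gamma5a1.m_assoc)
  finally show ?case
    by (simp add: beta_power_mult form_vadd_right)
qed

text \<open>Moving the letters of \<open>u\<close> past \<open>v\<close> one at a time produces
  powers of the central element \<beta>, whose exponents add up by bilinearity of the form.\<close>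

lemma words_swap:
  "elt u \<otimes>\<^bsub>Gamma5a1\<^esub> elt v =
     beta_power (form (exponents u) (exponents v)) \<otimes>\<^bsub>Gamma5a1\<^esub> (elt v \<otimes>\<^bsub>Gamma5a1\<^esub> elt u)"
proof (induction u)
  case Nil
  then show ?case by (simp add: beta_power_def)
next
  case (Cons l u)
  let ?b = "beta_power (form (unit_vec (base l)) (exponents v))"
  let ?c = "beta_power (form (exponents u) (exponents v))"
  have "elt (l # u) \<otimes>\<^bsub>Gamma5a1\<^esub> elt v = elt [l] \<otimes>\<^bsub>Gamma5a1\<^esub> (elt u \<otimes>\<^bsub>Gamma5a1\<^esub> elt v)"
    by (simp add: elt_Cons[of l u] Gamma5a1.m_assoc)
  also have "\<dots> = (elt [l] \<otimes>\<^bsub>Gamma5a1\<^esub> ?c) \<otimes>\<^bsub>Gamma5a1\<^esub> (elt v \<otimes>\<^bsub>Gamma5a1\<^esub> elt u)"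
    by (simp add: Cons.IH Gamma5a1.m_assoc)
  also have "\<dots> = ?c \<otimes>\<^bsub>Gamma5a1\<^esub> ((elt [l] \<otimes>\<^bsub>Gamma5a1\<^esub> elt v) \<otimes>\<^bsub>Gamma5a1\<^esub> elt u)"
    by (simp add: beta_power_commutes Gamma5a1.m_assoc)
  also have "elt [l] \<otimes>\<^bsub>Gamma5a1\<^esub> elt v = ?b \<otimes>\<^bsub>Gamma5a1\<^esub> (elt v \<otimes>\<^bsub>Gamma5a1\<^esub> elt [l])"
    by (rule letter_word_swap)
  also have "?c \<otimes>\<^bsub>Gamma5a1\<^esub> (\<dots> \<otimes>\<^bsub>Gamma5a1\<^esub> elt u) =
      (?c \<otimes>\<^bsub>Gamma5a1\<^esub> ?b) \<otimes>\<^bsub>Gamma5a1\<^esub> (elt v \<otimes>\<^bsub>Gamma5a1\<^esub> elt (l # u))"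
    by (simp add: elt_Cons[of l u] Gamma5a1.m_assoc)
  also have "?c \<otimes>\<^bsub>Gamma5a1\<^esub> ?b = beta_power (form (exponents (l # u)) (exponents v))"
    by (simp add: beta_power_mult form_vadd_left eq_commute)
  finally show ?case .
qed

lemma elt_commute_iff:
  "elt u \<otimes>\<^bsub>Gamma5a1\<^esub> elt v = elt v \<otimes>\<^bsub>Gamma5a1\<^esub> elt u \<longleftrightarrow> \<not> form (exponents u) (exponents v)"
proof
  assume comm: "elt u \<otimes>\<^bsub>Gamma5a1\<^esub> elt v = elt v \<otimes>\<^bsub>Gamma5a1\<^esub> elt u"
  show "\<not> form (exponents u) (exponents v)"
  proof
    assume "form (exponents u) (exponents v)"
    then have "elt u \<otimes>\<^bsub>Gamma5a1\<^esub> elt v = elt [Pos Beta] \<otimes>\<^bsub>Gamma5a1\<^esub> (elt v \<otimes>\<^bsub>Gamma5a1\<^esub> elt u)"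
      by (subst words_swap) (simp add: beta_power_def)
    \<comment> \<open>This would make \<beta> trivial. The action on normal forms refutes it,
      because \<beta> moves every normal form.\<close>
    then have "elt (v @ u) = elt (Pos Beta # v @ u)"
      unfolding comm by (simp only: elt_append[symmetric] append.simps)
    then have "word_act (v @ u) (vzero, False) = word_act (Pos Beta # v @ u) (vzero, False)"
      unfolding word_class_eq_iff by (rule word_act_cong)
    then show False
      using left_mult_Beta by (metis base.simps(1) word_act_simps(2))
  qed
next
  assume "\<not> form (exponents u) (exponents v)"
  then show "elt u \<otimes>\<^bsub>Gamma5a1\<^esub> elt v = elt v \<otimes>\<^bsub>Gamma5a1\<^esub> elt u"
    using words_swap[of u v] by (simp add: beta_power_def)
qed

section \<open>The centre and its cosets\<close>

lemma elt_in_center_iff: "elt w \<in> center Gamma5a1 \<longleftrightarrow> exponents w = vzero"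
proof
  assume c: "elt w \<in> center Gamma5a1"
  show "exponents w = vzero"
  proof (rule form_nondegenerate)
    fix q
    obtain v where "exponents v = q"
      using exponents_surj by blast
    with c elt_commute_iff[of w v] show "\<not> form (exponents w) q"
      by (auto simp: center_def)
  qed
next
  assume "exponents w = vzero"
  then show "elt w \<in> center Gamma5a1"
    by (auto simp: center_def carrier_Gamma5a1 elt_commute_iff)
qed

lemma (in group) subgroup_center: "subgroup (center G) G"
proof (rule subgroupI)
  show "center G \<subseteq> carrier G" by (auto simp: center_def)
  show "center G \<noteq> {}" by (auto simp: center_def)
next
  fix a assume a: "a \<in> center G"
  then have "a \<in> carrier G" by (simp add: center_def)
  moreover have "inv a \<otimes> g = g \<otimes> inv a" if g: "g \<in> carrier G" for g
  proof -
    have "a \<otimes> inv g = inv g \<otimes> a" using a g by (simp add: center_def)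
    then have "inv (a \<otimes> inv g) = inv (inv g \<otimes> a)" by simp
    then show ?thesis using \<open>a \<in> carrier G\<close> g by (simp add: inv_mult_group)
  qed
  ultimately show "inv a \<in> center G" by (simp add: center_def)
next
  fix a b assume "a \<in> center G" "b \<in> center G"
  then have ab: "a \<in> carrier G" "b \<in> carrier G"
    and comm: "\<And>g. g \<in> carrier G \<Longrightarrow> a \<otimes> g = g \<otimes> a" "\<And>g. g \<in> carrier G \<Longrightarrow> b \<otimes> g = g \<otimes> b"
    unfolding center_def by blast+
  have "a \<otimes> b \<otimes> g = g \<otimes> (a \<otimes> b)" if g: "g \<in> carrier G" for g
    using ab g by (metis comm m_assoc)
  with ab show "a \<otimes> b \<in> center G"
    unfolding center_def by blast
qed

lemma (in group) r_coset_eq_iff: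
  assumes "subgroup H G" "x \<in> carrier G" "y \<in> carrier G"
  shows "H #> x = H #> y \<longleftrightarrow> y \<in> H #> x"
  using repr_independence[OF _ assms(2,1)] repr_independenceD[OF assms(1,3)] by blast

text \<open>Together with \<open>exponents_surj\<close> this identifies the central quotient with
  the set of all sixteen vectors.\<close>

lemma center_coset_eq_iff:
  "center Gamma5a1 #>\<^bsub>Gamma5a1\<^esub> elt u = center Gamma5a1 #>\<^bsub>Gamma5a1\<^esub> elt v \<longleftrightarrow>
     exponents u = exponents v"
proof -
  have "elt v \<in> center Gamma5a1 #>\<^bsub>Gamma5a1\<^esub> elt u \<longleftrightarrow> exponents u = exponents v"
  proof
    assume "elt v \<in> center Gamma5a1 #>\<^bsub>Gamma5a1\<^esub> elt u"
    then obtain c where c: "c \<in> center Gamma5a1" "elt v = c \<otimes>\<^bsub>Gamma5a1\<^esub> elt u"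
      by (auto simp: r_coset_def)
    then obtain w where w: "c = elt w"
      by (auto simp: center_def carrier_Gamma5a1)
    have "exponents v = exponents (w @ u)"
      using c by (intro elt_eq_exponents) (simp add: w elt_append)
    with c show "exponents u = exponents v"
      by (simp add: w elt_in_center_iff)
  next
    assume eq: "exponents u = exponents v"
    obtain w where w: "elt v \<otimes>\<^bsub>Gamma5a1\<^esub> inv\<^bsub>Gamma5a1\<^esub> elt u = elt w"
      by (metis Gamma5a1.inv_closed Gamma5a1.m_closed elt_closed carrier_Gamma5a1 imageE)
    then have v: "elt v = elt w \<otimes>\<^bsub>Gamma5a1\<^esub> elt u"
      by (metis Gamma5a1.inv_closed Gamma5a1.m_assoc Gamma5a1.l_inv Gamma5a1.r_one elt_closed)
    then have "exponents v = vadd (exponents w) (exponents u)"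
      using elt_eq_exponents[of v "w @ u"] by (simp add: elt_append)
    with eq have "exponents w = vzero"
      by (metis vadd_assoc vadd_self vadd_vzero(2))
    with v show "elt v \<in> center Gamma5a1 #>\<^bsub>Gamma5a1\<^esub> elt u"
      by (auto simp: r_coset_def elt_in_center_iff)
  qed
  then show ?thesis
    using Gamma5a1.r_coset_eq_iff[OF Gamma5a1.subgroup_center] by simp
qed

section \<open>Orbits of simultaneous conjugation\<close>

lemma (in group) conj_eq_self_iff:
  assumes "g \<in> carrier G" "x \<in> carrier G"
  shows "g \<otimes> x \<otimes> inv g = x \<longleftrightarrow> g \<otimes> x = x \<otimes> g"
  using assms by (simp add: inv_solve_right')

lemma (in group) conj_mult:
  assumes "g \<in> carrier G" "h \<in> carrier G" "x \<in> carrier G"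
  shows "g \<otimes> h \<otimes> x \<otimes> inv (g \<otimes> h) = g \<otimes> (h \<otimes> x \<otimes> inv h) \<otimes> inv g"
  using assms by (simp add: inv_mult_group m_assoc)

text \<open>Stated for any conjugation-invariant set \<open>E\<close> of tuples, to cover both all
  tuples and the commuting ones.\<close>

lemma (in group) simultaneous_conj_action:
  assumes E: "\<And>xs. xs \<in> E \<Longrightarrow> set xs \<subseteq> carrier G"
    and closed: "\<And>g xs. g \<in> carrier G \<Longrightarrow> xs \<in> E \<Longrightarrow> map (\<lambda>x. g \<otimes> x \<otimes> inv g) xs \<in> E"
  shows "group_action G E (simultaneous_conj G E)"
proof -
  let ?c = "simultaneous_conj G E"
  have comp: "?c (g \<otimes> h) xs = ?c g (?c h xs)"
    if "g \<in> carrier G" "h \<in> carrier G" "xs \<in> E" for g h xs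
    using that E[OF that(3)] closed by (auto simp: simultaneous_conj_def conj_mult)
  have one: "?c \<one> xs = xs" if "xs \<in> E" for xs
    using that E[OF that] by (auto simp: simultaneous_conj_def subset_iff intro!: map_idI)
  have maps: "?c g xs \<in> E" if "g \<in> carrier G" "xs \<in> E" for g xs
    using that closed by (simp add: simultaneous_conj_def)
  have bij: "?c g \<in> Bij E" if g: "g \<in> carrier G" for g
  proof -
    have "bij_betw (?c g) E E"
      by (rule bij_betw_byWitness[where f' = "?c (inv g)"])
        (use g maps one in \<open>auto simp flip: comp\<close>)
    then show ?thesis
      by (simp add: Bij_def simultaneous_conj_def)
  qed
  have "group_hom G (BijGroup E) ?c"
  proof (intro group_hom.intro group_hom_axioms.intro homI)
    show "group G" by (rule is_group)
    show "group (BijGroup E)" by (rule group_BijGroup)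
    show "?c g \<in> carrier (BijGroup E)" if "g \<in> carrier G" for g
      using bij[OF that] by (simp add: BijGroup_def)
    show "?c (g \<otimes> h) = ?c g \<otimes>\<^bsub>BijGroup E\<^esub> ?c h"
      if "g \<in> carrier G" "h \<in> carrier G" for g h
    proof -
      have "?c g \<otimes>\<^bsub>BijGroup E\<^esub> ?c h = compose E (?c g) (?c h)"
        using bij[OF that(1)] bij[OF that(2)] by (simp add: BijGroup_def)
      moreover have "?c (g \<otimes> h) xs = compose E (?c g) (?c h) xs" for xs
      proof (cases "xs \<in> E")
        case True
        then show ?thesis by (simp add: compose_def comp[OF that])
      next
        \<comment> \<open>Both maps are extensional, so outside \<open>E\<close> they agree with the
          value \<open>undefined\<close>.\<close>
        case False
        then show ?thesis by (simp add: compose_def simultaneous_conj_def)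
      qed
      ultimately show ?thesis by (simp add: fun_eq_iff)
    qed
  qed
  then show ?thesis
    by (rule group_action.intro)
qed

text \<open>Burnside's lemma: a tuple is fixed by \<open>g\<close> exactly when each of its entries
  commutes with \<open>g\<close>.\<close>

lemma (in group) card_orbits_simultaneous_conj:
  assumes fin: "finite (carrier G)" "finite E"
    and E: "\<And>xs. xs \<in> E \<Longrightarrow> set xs \<subseteq> carrier G"
    and closed: "\<And>g xs. g \<in> carrier G \<Longrightarrow> xs \<in> E \<Longrightarrow> map (\<lambda>x. g \<otimes> x \<otimes> inv g) xs \<in> E"
  shows "card (orbits G E (simultaneous_conj G E)) * order G =
    (\<Sum>g\<in>carrier G. card {xs \<in> E. \<forall>x\<in>set xs. g \<otimes> x = x \<otimes> g})"
proof -
  interpret group_action G E "simultaneous_conj G E"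
    by (rule simultaneous_conj_action[OF E closed])
  have "invariants E (simultaneous_conj G E) g = {xs \<in> E. \<forall>x\<in>set xs. g \<otimes> x = x \<otimes> g}"
    if "g \<in> carrier G" for g
  proof -
    have "map (\<lambda>x. g \<otimes> x \<otimes> inv g) xs = xs \<longleftrightarrow> (\<forall>x\<in>set xs. g \<otimes> x = x \<otimes> g)" if "xs \<in> E" for xs
    proof -
      have "map (\<lambda>x. g \<otimes> x \<otimes> inv g) xs = xs \<longleftrightarrow> (\<forall>x\<in>set xs. g \<otimes> x \<otimes> inv g = x)"
        by (induction xs) auto
      also have "\<dots> \<longleftrightarrow> (\<forall>x\<in>set xs. g \<otimes> x = x \<otimes> g)"
        using E[OF that] by (intro ball_cong refl conj_eq_self_iff \<open>g \<in> carrier G\<close>) (rule subsetD)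
      finally show ?thesis .
    qed
    then show ?thesis
      by (auto simp: invariants_def simultaneous_conj_def)
  qed
  with burnside[OF fin] show ?thesis by simp
qed

lemma (in group) alpha_count_eq:
  assumes fin: "finite (carrier G)"
  shows "alpha_count G n * order G =
    (\<Sum>g\<in>carrier G. card {x \<in> carrier G. g \<otimes> x = x \<otimes> g} ^ n)"
proof -
  have E: "tuples G n = {xs. set xs \<subseteq> carrier G \<and> length xs = n}"
    by (auto simp: tuples_def)
  have "alpha_count G n * order G =
      (\<Sum>g\<in>carrier G. card {xs \<in> tuples G n. \<forall>x\<in>set xs. g \<otimes> x = x \<otimes> g})"
    unfolding alpha_count_def
    by (rule card_orbits_simultaneous_conj) (use fin in \<open>auto simp: E finite_lists_length_eq\<close>)
  moreover have "{xs \<in> tuples G n. \<forall>x\<in>set xs. g \<otimes> x = x \<otimes> g} =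
      {xs. set xs \<subseteq> {x \<in> carrier G. g \<otimes> x = x \<otimes> g} \<and> length xs = n}" for g
    by (auto simp: E)
  ultimately show ?thesis
    using fin by (simp add: card_lists_length_eq)
qed

lemma commuting_tuples_eq:
  "commuting_tuples G n = related_tuples (\<lambda>x y. x \<otimes>\<^bsub>G\<^esub> y = y \<otimes>\<^bsub>G\<^esub> x) (carrier G) n"
  by (auto simp: commuting_tuples_def related_tuples_def tuples_def)

text \<open>By Burnside, \<open>\<beta>\<^sub>n |G|\<close> counts the pairs of a commuting \<open>n\<close>-tuple and an element
  commuting with all its entries.\<close>

lemma (in group) beta_count_eq:
  assumes fin: "finite (carrier G)"
  shows "beta_count G n * order G = card (commuting_tuples G (Suc n))"
proof -
  let ?R = "\<lambda>x y. x \<otimes> y = y \<otimes> x"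
  have conj: "map (\<lambda>x. g \<otimes> x \<otimes> inv g) xs \<in> commuting_tuples G n"
    if g: "g \<in> carrier G" and xs: "xs \<in> commuting_tuples G n" for g xs
  proof -
    have conj2: "(g \<otimes> x \<otimes> inv g) \<otimes> (g \<otimes> y \<otimes> inv g) = g \<otimes> (x \<otimes> y) \<otimes> inv g"
      if "x \<in> carrier G" "y \<in> carrier G" for x y
    proof -
      have "(g \<otimes> x \<otimes> inv g) \<otimes> (g \<otimes> y \<otimes> inv g) = g \<otimes> x \<otimes> (inv g \<otimes> g) \<otimes> (y \<otimes> inv g)"
        using g that by (simp only: m_assoc m_closed inv_closed)
      with g that show ?thesis by (simp add: m_assoc)
    qed
    have "(g \<otimes> x \<otimes> inv g) \<otimes> (g \<otimes> y \<otimes> inv g) = (g \<otimes> y \<otimes> inv g) \<otimes> (g \<otimes> x \<otimes> inv g)"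
      if "x \<in> set xs" "y \<in> set xs" for x y
    proof -
      have "x \<in> carrier G" "y \<in> carrier G" "x \<otimes> y = y \<otimes> x"
        using that xs by (auto simp: commuting_tuples_def tuples_def)
      then show ?thesis by (simp add: conj2)
    qed
    with g xs show ?thesis
      by (auto simp: commuting_tuples_def tuples_def)
  qed
  have "beta_count G n * order G =
      (\<Sum>g\<in>carrier G. card {xs \<in> commuting_tuples G n. \<forall>x\<in>set xs. g \<otimes> x = x \<otimes> g})"
    unfolding beta_count_def
    by (rule card_orbits_simultaneous_conj[OF fin _ _ conj])
      (use fin in \<open>auto simp: commuting_tuples_eq related_tuples_def
          intro: finite_subset[OF _ finite_lists_length_eq[OF fin, of n]]\<close>)
  also have "\<dots> = (\<Sum>g\<in>carrier G. card (related_tuples ?R {x \<in> carrier G. ?R g x} n))"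
    by (intro sum.cong refl arg_cong[where f = card])
      (auto simp: commuting_tuples_eq related_tuples_def)
  also have "\<dots> = card (commuting_tuples G (Suc n))"
    unfolding commuting_tuples_eq by (rule card_related_tuples_Suc[symmetric]) (use fin in auto)
  finally show ?thesis .
qed

section \<open>Coordinates from an isoclinism\<close>

lemma (in group) commutator_eq_one_iff:
  assumes "x \<in> carrier G" "y \<in> carrier G"
  shows "commutator G x y = \<one> \<longleftrightarrow> x \<otimes> y = y \<otimes> x"
proof -
  have "commutator G x y = (x \<otimes> y) \<otimes> inv (y \<otimes> x)"
    using assms by (simp add: commutator_def inv_mult_group m_assoc)
  then show ?thesis
    using assms by (metis inv_closed inv_solve_right m_closed r_inv l_one one_closed)
qed

lemma (in group) commutator_in_derived:
  assumes "x \<in> carrier G" "y \<in> carrier G"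
  shows "commutator G x y \<in> derived G (carrier G)"
  unfolding derived_def commutator_def by (rule generate.incl UN_I[OF assms(1)] UN_I[OF assms(2)] singletonI)+

lemma (in group) group_derived_group: "group (derived_group G)"
  unfolding derived_group_def by (rule subgroup_imp_group[OF derived_is_subgroup]) simp

text \<open>Commuting means having trivial commutator, and the injective homomorphism
  \<open>\<phi>\<close> sends exactly the identity to the identity.\<close>

lemma isoclinic_commute_iff:
  assumes "group G" "group H"
    and \<phi>: "\<phi> \<in> iso (derived_group G) (derived_group H)"
    and comm: "\<phi> (commutator G g1 g2) = commutator H h1 h2"
    and "g1 \<in> carrier G" "g2 \<in> carrier G" "h1 \<in> carrier H" "h2 \<in> carrier H"
  shows "g1 \<otimes>\<^bsub>G\<^esub> g2 = g2 \<otimes>\<^bsub>G\<^esub> g1 \<longleftrightarrow> h1 \<otimes>\<^bsub>H\<^esub> h2 = h2 \<otimes>\<^bsub>H\<^esub> h1"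
proof -
  interpret G: group G by fact
  interpret H: group H by fact
  have "group_hom (derived_group G) (derived_group H) \<phi>"
    using \<phi> by (intro group_hom.intro group_hom_axioms.intro G.group_derived_group
        H.group_derived_group) (simp add: iso_def)
  from group_hom.hom_one[OF this] have "\<phi> \<one>\<^bsub>G\<^esub> = \<one>\<^bsub>H\<^esub>"
    by (simp add: derived_group_def)
  moreover have "inj_on \<phi> (derived G (carrier G))"
    using \<phi> by (simp add: iso_def bij_betw_def derived_group_def)
  moreover have "\<one>\<^bsub>G\<^esub> \<in> derived G (carrier G)"
    by (simp add: derived_def generate.one)
  ultimately have "commutator G g1 g2 = \<one>\<^bsub>G\<^esub> \<longleftrightarrow> commutator H h1 h2 = \<one>\<^bsub>H\<^esub>"
    using comm G.commutator_in_derived[OF assms(5,6)] by (metis inj_onD)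
  then show ?thesis
    using assms by (simp add: G.commutator_eq_one_iff H.commutator_eq_one_iff)
qed

text \<open>The coordinate vector of \<open>g\<close> is the exponent vector of any word
  representing the coset that \<open>\<theta>\<close> assigns to the coset of
  \<open>g\<close>.\<close>

lemma isoclinic_Gamma5a1_coordinates:
  assumes "group G" "isoclinic G Gamma5a1"
  obtains V :: "'a \<Rightarrow> vec4" where
    "\<And>p. card {g \<in> carrier G. V g = p} = card (center G)"
    "\<And>g h. g \<in> carrier G \<Longrightarrow> h \<in> carrier G \<Longrightarrow> g \<otimes>\<^bsub>G\<^esub> h = h \<otimes>\<^bsub>G\<^esub> g \<longleftrightarrow> \<not> form (V g) (V h)"
proof -
  interpret G: group G by fact
  let ?q = "\<lambda>g. center G #>\<^bsub>G\<^esub> g"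
  let ?r = "\<lambda>w. center Gamma5a1 #>\<^bsub>Gamma5a1\<^esub> elt w"
  from assms(2) obtain \<theta> \<phi> where
    \<theta>: "\<theta> \<in> iso (G Mod center G) (Gamma5a1 Mod center Gamma5a1)" and
    \<phi>: "\<phi> \<in> iso (derived_group G) (derived_group Gamma5a1)" and
    comm: "\<And>g1 g2 h1 h2. g1 \<in> carrier G \<Longrightarrow> g2 \<in> carrier G \<Longrightarrow>
      h1 \<in> carrier Gamma5a1 \<Longrightarrow> h2 \<in> carrier Gamma5a1 \<Longrightarrow>
      \<theta> (?q g1) = center Gamma5a1 #>\<^bsub>Gamma5a1\<^esub> h1 \<Longrightarrow>
      \<theta> (?q g2) = center Gamma5a1 #>\<^bsub>Gamma5a1\<^esub> h2 \<Longrightarrow>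
      \<phi> (commutator G g1 g2) = commutator Gamma5a1 h1 h2"
    unfolding isoclinic_def by blast
  have bij: "bij_betw \<theta> (?q ` carrier G) (range ?r)"
  proof -
    have "bij_betw \<theta> (rcosets\<^bsub>G\<^esub> center G) (rcosets\<^bsub>Gamma5a1\<^esub> center Gamma5a1)"
      using \<theta> by (simp add: iso_def FactGroup_def)
    moreover have "rcosets\<^bsub>G\<^esub> center G = ?q ` carrier G"
      by (auto simp: RCOSETS_def)
    moreover have "rcosets\<^bsub>Gamma5a1\<^esub> center Gamma5a1 = range ?r"
      by (auto simp: RCOSETS_def carrier_Gamma5a1)
    ultimately show ?thesis by simp
  qed
  have "\<exists>w. \<theta> (?q g) = ?r w" if "g \<in> carrier G" for g
    using bij_betw_apply[OF bij, of "?q g"] that by blast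
  then obtain w where w: "\<And>g. g \<in> carrier G \<Longrightarrow> \<theta> (?q g) = ?r (w g)"
    by metis
  let ?V = "\<lambda>g. exponents (w g)"
  have V_eq: "?V g = ?V h \<longleftrightarrow> ?q g = ?q h" if "g \<in> carrier G" "h \<in> carrier G" for g h
  proof -
    have "?V g = ?V h \<longleftrightarrow> \<theta> (?q g) = \<theta> (?q h)"
      using that by (simp add: w center_coset_eq_iff)
    also have "\<dots> \<longleftrightarrow> ?q g = ?q h"
      using bij that by (intro inj_on_eq_iff[of \<theta> "?q ` carrier G"]) (auto simp: bij_betw_def)
    finally show ?thesis .
  qed
  have fibre: "card {g \<in> carrier G. ?V g = p} = card (center G)" for p
  proof -
    obtain u where u: "exponents u = p"
      using exponents_surj by blast
    \<comment> \<open>Surjectivity of \<open>\<theta>\<close> makes the fibre nonempty; by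
      \<open>V_eq\<close> it is then a full coset of the centre.\<close>
    have "?r u \<in> \<theta> ` ?q ` carrier G"
      using bij by (simp add: bij_betw_def)
    then obtain g0 where g0: "g0 \<in> carrier G" "\<theta> (?q g0) = ?r u"
      by auto
    then have "?V g0 = p"
      using w[of g0] u by (metis center_coset_eq_iff)
    have sub: "center G \<subseteq> carrier G"
      by (rule subgroup.subset[OF G.subgroup_center])
    have "?V g = p \<longleftrightarrow> g \<in> ?q g0" if "g \<in> carrier G" for g
      using V_eq[OF g0(1) that] G.r_coset_eq_iff[OF G.subgroup_center g0(1) that] \<open>?V g0 = p\<close>
      by metis
    then have "{g \<in> carrier G. ?V g = p} = ?q g0"
      using G.r_coset_subset_G[OF sub g0(1)] by blast
    moreover have "?q g0 \<in> rcosets\<^bsub>G\<^esub> center G"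
      using g0(1) unfolding RCOSETS_def by blast
    ultimately show ?thesis
      using G.card_rcosets_equal[OF _ sub] by simp
  qed
  have "g \<otimes>\<^bsub>G\<^esub> h = h \<otimes>\<^bsub>G\<^esub> g \<longleftrightarrow> \<not> form (?V g) (?V h)"
    if "g \<in> carrier G" "h \<in> carrier G" for g h
  proof -
    have "\<phi> (commutator G g h) = commutator Gamma5a1 (elt (w g)) (elt (w h))"
      by (rule comm[OF that elt_closed elt_closed w[OF that(1)] w[OF that(2)]])
    from isoclinic_commute_iff[OF assms(1) group_Gamma5a1 \<phi> this that elt_closed elt_closed]
    show ?thesis
      unfolding elt_commute_iff .
  qed
  with fibre show ?thesis
    by (rule that)
qed

section \<open>The generating functions\<close>

text \<open>Here |G| = 16 z with z = |Z(G)|. Central elements correspond to the zero vector and have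
  centraliser G; all others have a centraliser of order 8 z. Denominators are cleared, and the
  second identity is in integers because of the minus sign.\<close>

lemma orbit_counts_Gamma5:
  assumes "group G" "finite (carrier G)" "isoclinic G Gamma5a1"
  shows "16 * 2 ^ n * alpha_count G n = order G ^ n * (2 ^ n + 15)"
    and "int (16 * 16 ^ n * beta_count G n) = int (order G) ^ n * (60 * 4 ^ n - 60 * 2 ^ n + 16)"
proof -
  interpret G: group G by fact
  define z where "z = card (center G)"
  obtain V where fib: "\<And>p. card {g \<in> carrier G. V g = p} = z"
    and V: "\<And>g h. g \<in> carrier G \<Longrightarrow> h \<in> carrier G \<Longrightarrow>
        g \<otimes>\<^bsub>G\<^esub> h = h \<otimes>\<^bsub>G\<^esub> g \<longleftrightarrow> \<not> form (V g) (V h)"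
    by (rule isoclinic_Gamma5a1_coordinates[OF assms(1,3)]) (rule that[unfolded z_def])
  note fin = assms(2)
  have order: "order G = 16 * z"
    using card_constant_fibres[OF fin fib, of "\<lambda>_. True"] by (simp add: order_def card_vec4_UNIV)
  have "z > 0"
    using order G.order_gt_0_iff_finite fin by simp
  have "alpha_count G n * order G = (\<Sum>g\<in>carrier G. (z * card {q. \<not> form (V g) q}) ^ n)"
    unfolding G.alpha_count_eq[OF fin]
    by (intro sum.cong refl arg_cong2[where f = power])
      (simp add: V flip: card_constant_fibres[OF fin fib] cong: conj_cong)
  also have "\<dots> = z * (\<Sum>p\<in>UNIV. (z * card {q. \<not> form p q}) ^ n)"
    by (rule sum_constant_fibres[OF fin fib])
  also have "(\<Sum>p\<in>UNIV. (z * card {q. \<not> form p q}) ^ n) =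
      (z * card {q. \<not> form vzero q}) ^ n + (\<Sum>p\<in>UNIV - {vzero}. (z * card {q. \<not> form p q}) ^ n)"
    by (rule sum.remove) auto
  also have "(\<Sum>p\<in>UNIV - {vzero}. (z * card {q. \<not> form p q}) ^ n) =
      (\<Sum>p\<in>UNIV - {vzero :: vec4}. (z * 8) ^ n)"
    by (intro sum.cong refl) (simp add: card_orthogonal)
  finally have "alpha_count G n * order G = z * ((16 * z) ^ n + 15 * (8 * z) ^ n)"
    by (simp add: card_vec4_UNIV card_Diff_subset mult.commute)
  then have "16 * alpha_count G n = (16 * z) ^ n + 15 * (8 * z) ^ n"
    using \<open>z > 0\<close> by (simp add: order)
  note alpha = this
  have pow: "2 ^ n * (8 * z) ^ n = (16 * z) ^ n"
    by (subst power_mult_distrib[symmetric]) simp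
  have "16 * 2 ^ n * alpha_count G n = 2 ^ n * (16 * alpha_count G n)"
    by (simp only: ac_simps)
  also have "\<dots> = 2 ^ n * (16 * z) ^ n + 15 * (2 ^ n * (8 * z) ^ n)"
    unfolding alpha by (simp only: distrib_left mult.left_commute)
  also have "\<dots> = order G ^ n * (2 ^ n + 15)"
    unfolding pow order by (simp only: distrib_left ac_simps)
  finally show "16 * 2 ^ n * alpha_count G n = order G ^ n * (2 ^ n + 15)" .
  have commuting_iff: "(\<forall>x\<in>set xs. \<forall>y\<in>set xs. x \<otimes>\<^bsub>G\<^esub> y = y \<otimes>\<^bsub>G\<^esub> x) \<longleftrightarrow>
      (\<forall>x\<in>set xs. \<forall>y\<in>set xs. \<not> form (V x) (V y))" if "set xs \<subseteq> carrier G" for xs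
    by (intro ball_cong refl V) (use that in blast)+
  have "commuting_tuples G (Suc n) =
      related_tuples (\<lambda>x y. \<not> form (V x) (V y)) {x \<in> carrier G. True} (Suc n)"
    unfolding commuting_tuples_eq related_tuples_def
    by (intro Collect_cong conj_cong refl commuting_iff) simp_all
  also have "card \<dots> = z ^ Suc n * card (related_tuples (\<lambda>p q. \<not> form p q) {p. True} (Suc n))"
    by (rule card_related_tuples_fibres[OF fin fib]) (simp_all add: form_sym)
  finally have "beta_count G n * order G =
      z ^ Suc n * card (related_tuples (\<lambda>p q. \<not> form p q) UNIV (Suc n))"
    by (simp only: G.beta_count_eq[OF fin] UNIV_def)
  \<comment> \<open>One of the n+1 factors z cancels against the z in |G| = 16 z.\<close>
  then have "z * (16 * beta_count G n) =
      z * (z ^ n * card (related_tuples (\<lambda>p q. \<not> form p q) UNIV (Suc n)))"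
    by (simp only: order power_Suc ac_simps)
  then have "16 * beta_count G n = z ^ n * card (related_tuples (\<lambda>p q. \<not> form p q) UNIV (Suc n))"
    using \<open>z > 0\<close> by (simp only: mult_cancel1) simp
  then have "int (16 * beta_count G n) = int z ^ n * (15 * 4 ^ Suc n - 30 * 2 ^ Suc n + 16)"
    by (simp only: of_nat_mult of_nat_power card_isotropic_tuples)
  then have beta: "int (16 * beta_count G n) = int z ^ n * (60 * 4 ^ n - 60 * 2 ^ n + 16)"
    by simp
  have "int (16 * 16 ^ n * beta_count G n) = 16 ^ n * int (16 * beta_count G n)"
    by simp
  also have "\<dots> = int (order G) ^ n * (60 * 4 ^ n - 60 * 2 ^ n + 16)"
    unfolding beta by (simp only: order of_nat_mult power_mult_distrib of_nat_numeral mult.assoc)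
  finally show "int (16 * 16 ^ n * beta_count G n) = int (order G) ^ n * (60 * 4 ^ n - 60 * 2 ^ n + 16)" .
qed

section \<open>Geometric series and the partial fractions\<close>

lemma fps_geometric:
  fixes a c :: "'a :: field"
  shows "fps_const a / (1 - fps_const c * fps_X) = Abs_fps (\<lambda>n. a * c ^ n)"
proof -
  let ?F = "Abs_fps (\<lambda>n. a * c ^ n)"
  have "(1 - fps_const c * fps_X) * ?F = fps_const a"
  proof (rule fps_ext)
    fix n
    show "fps_nth ((1 - fps_const c * fps_X) * ?F) n = fps_nth (fps_const a) n"
      by (cases n) (simp_all add: left_diff_distrib mult.assoc)
  qed
  moreover have "fps_nth (1 - fps_const c * fps_X) 0 \<noteq> 0"
    by simp
  then have "1 - fps_const c * fps_X \<noteq> 0"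
    by (metis fps_zero_nth)
  ultimately show ?thesis
    by (metis nonzero_mult_div_cancel_left)
qed

theorem lemma5p15:
  fixes G :: "('a, 'b) monoid_scheme" and m :: nat
  assumes "group G"
    and "order G = 2 ^ m"
    and "isoclinism_rank G = 5"
    and "belongs_to_Gamma5 G"
  shows "(A_series G oo (fps_const (1 / of_nat (order G)) * fps_X) =
           fps_const (1 - 1 / 2 ^ 4) / (1 - fps_const (1 / 2) * fps_X)
         + fps_const (1 / 2 ^ 4) / (1 - fps_X))
    \<and> (B_series G oo (fps_const (1 / of_nat (order G)) * fps_X) =
           1 / (1 - fps_const (1 / 2 ^ 4) * fps_X)
         + fps_const (- 3 - 1 / 2 - 1 / 2 ^ 2) / (1 - fps_const (1 / 2 ^ 3) * fps_X)
         + fps_const (3 + 1 / 2 + 1 / 2 ^ 2) / (1 - fps_const (1 / 2 ^ 2) * fps_X))"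
proof -
  have "order G > 0"
    using assms(2) by simp
  then have "finite (carrier G)"
    by (simp add: order_def card_gt_0_iff)
  with assms have counts:
    "16 * 2 ^ n * alpha_count G n = order G ^ n * (2 ^ n + 15)"
    "int (16 * 16 ^ n * beta_count G n) = int (order G) ^ n * (60 * 4 ^ n - 60 * 2 ^ n + 16)" for n
    by (simp_all only: orbit_counts_Gamma5 belongs_to_Gamma5_def)
  have "of_nat (alpha_count G n) / of_nat (order G) ^ n = (1 - 1 / 16) * (1 / 2) ^ n + (1 / 16 :: rat)"
    for n
    using arg_cong[OF counts(1)[of n], of "of_nat :: nat \<Rightarrow> rat"] \<open>order G > 0\<close>
    by (simp add: field_simps)
  \<comment> \<open>The coefficient 15/4 is 60/16, which equals 3 + 1/2 + 1/4.\<close>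
  moreover have "of_nat (beta_count G n) / of_nat (order G) ^ n =
      (1 / 16) ^ n - 15 / 4 * (1 / 8) ^ n + 15 / 4 * (1 / 4 :: rat) ^ n" for n
  proof -
    have "16 * 16 ^ n * of_nat (beta_count G n) =
        of_nat (order G) ^ n * (60 * 4 ^ n - 60 * 2 ^ n + 16 :: rat)"
      using arg_cong[OF counts(2)[of n], of "of_int :: int \<Rightarrow> rat"] by simp
    moreover have pow: "(2 ^ k) ^ n = ((2 :: rat) ^ n) ^ k" for k
      by (simp add: mult.commute flip: power_mult)
    \<comment> \<open>With every power written through 2^n, the claim is an identity of rational
      functions in one quantity.\<close>
    have pows: "(4 :: rat) ^ n = (2 ^ n)\<^sup>2" "(8 :: rat) ^ n = (2 ^ n) ^ 3" "(16 :: rat) ^ n = (2 ^ n) ^ 4"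
      using pow[of 2] pow[of 3] pow[of 4] by simp_all
    moreover note pows
    ultimately have "16 * (2 ^ n) ^ 4 * of_nat (beta_count G n) =
        of_nat (order G) ^ n * (60 * (2 ^ n)\<^sup>2 - 60 * 2 ^ n + 16 :: rat)"
      by simp
    then have "of_nat (beta_count G n) / of_nat (order G) ^ n =
        (60 * (2 ^ n)\<^sup>2 - 60 * 2 ^ n + 16 :: rat) / (16 * (2 ^ n) ^ 4)"
      using \<open>order G > 0\<close> by (simp add: field_simps)
    also have "\<dots> = 1 / (2 ^ n) ^ 4 - 15 / 4 * (1 / (2 ^ n) ^ 3) + 15 / 4 * (1 / (2 ^ n)\<^sup>2)"
      by (simp add: field_simps eval_nat_numeral)
    finally show ?thesis
      using pows by (simp add: power_one_over)
  qed
  \<comment> \<open>These two summands, with numerator 1 and ratio 1 respectively, do not literally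
    match the pattern of \<open>fps_geometric\<close>.\<close>
  moreover have "1 / (1 - fps_const (1 / 2 ^ 4) * fps_X) = Abs_fps (\<lambda>n. (1 / 2 ^ 4 :: rat) ^ n)"
    "fps_const (1 / 2 ^ 4) / (1 - fps_X) = Abs_fps (\<lambda>n. 1 / 2 ^ 4 :: rat)"
    using fps_geometric[of "1 :: rat" "1 / 2 ^ 4"] fps_geometric[of "1 / 2 ^ 4 :: rat" 1] by simp_all
  ultimately show ?thesis
    by (simp add: fps_geometric fps_eq_iff A_series_def B_series_def power_one_over)
qed

end
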